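(* Let $X$ be a Hilbert space and let $F$ be the closed unit ball of $X$. Let $\Omega\subset X$ be a nonempty, closed, convex set, let $\Omega_1,\ldots,\Omega_n\subset X$ ($n\ge 1$) be nonempty, closed, strictly convex sets, and suppose that at least one of the sets among $\Omega_1,\ldots,\Omega_n$ and $\Omega$ is bounded. Suppose further that $$\bigcap_{i=1}^n[\Omega_i\cap\Omega]=\emptyset.$$ Then the optimization problem $$\text{minimize } T(x)=\max\{T_F(x;\Omega_i): i=1,\ldots,n\}\quad\text{subject to } x\in\Omega$$ has a unique solution.
   Context: For a nonempty set $Q\subset X$ and $x\in X$, the minimal time function is $T_F(x;Q)=\inf\{t\ge 0: (x+tF)\cap Q\ne\emptyset\}$; when $F$ is the closed unit ball it equals the distance $d(x;Q)=\inf\{\|x-q\|: q\in Q\}$. A set $A\subset X$ is strictly convex if for any $x,y\in A$ with $x\ne y$ and any $t\in(0,1)$ one has $tx+(1-t)y\in\operatorname{int}A$. A solution of the optimization problem is a point $\bar x\in\Omega$ with $T(\bar x)\le T(x)$ for all $x\in\Omega$. *)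

theory Defs
  imports "HOL-Analysis.Analysis"
begin

(* Values are extended reals: if no t is admissible, the infimum is infinity. *)
definition minimal_time ::
    "'a::real_normed_vector set \<Rightarrow> 'a \<Rightarrow> 'a set \<Rightarrow> ereal" where
  "minimal_time F x Q =
     Inf (ereal ` {t::real. t \<ge> 0 \<and> ((\<lambda>f. x + t *\<^sub>R f) ` F) \<inter> Q \<noteq> {}})"

definition strictly_convex :: "'a::real_normed_vector set \<Rightarrow> bool" where
  "strictly_convex A \<longleftrightarrow>
     (\<forall>x\<in>A. \<forall>y\<in>A. x \<noteq> y \<longrightarrow>
        (\<forall>t::real. 0 < t \<and> t < 1 \<longrightarrow> t *\<^sub>R x + (1 - t) *\<^sub>R y \<in> interior A))"

(* Only meaningful for n >= 1, where the maximum is over a nonempty finite set. *)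
definition max_time ::
    "'a::real_normed_vector set \<Rightarrow> (nat \<Rightarrow> 'a set) \<Rightarrow> nat \<Rightarrow> 'a \<Rightarrow> ereal" where
  "max_time F Q n x = Max ((\<lambda>i. minimal_time F x (Q i)) ` {1..n})"

definition is_solution :: "('a \<Rightarrow> 'b::linorder) \<Rightarrow> 'a set \<Rightarrow> 'a \<Rightarrow> bool" where
  "is_solution T C x \<longleftrightarrow> x \<in> C \<and> (\<forall>y\<in>C. T x \<le> T y)"

end

theory Submission imports Defs begin

text \<open>For the unit ball the minimal time function is the distance, so T is a maximum of distances to
  convex sets. Its sublevel sets in C are closed, convex and bounded, and in a Hilbert space such
  sets, if nested and nonempty, have a common point: almost-shortest vectors form a Cauchy sequence
  by the parallelogram law. This gives a minimizer, and likewise nearest points.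
  The minimum is positive because the sets have no common point in C. The midpoint of two
  distinct minimizers would have a smaller value: for each i either the two nearest points in
  \<Omega> i differ, and their midpoint is interior to \<Omega> i and hence not nearest, or they
  coincide, and strict convexity of the ball applies.\<close>

section \<open>Hilbert space geometry: nested convex sets, nearest points, sublevel sets of the
  distance\<close>

lemma norm_diff_midpoint:
  fixes x y :: "'a::real_inner"
  shows "(norm (x - y))\<^sup>2 = 2 * (norm x)\<^sup>2 + 2 * (norm y)\<^sup>2 - 4 * (norm (midpoint x y))\<^sup>2"
proof -
  have "4 * (norm (midpoint x y))\<^sup>2 = (norm (x + y))\<^sup>2"
    by (simp add: midpoint_def power_divide)
  then show ?thesis
    by (simp add: power2_norm_eq_inner inner_diff_left inner_diff_right
      inner_add_left inner_add_right inner_commute)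
qed

lemma midpoint_in_convex:
  assumes "convex S" "x \<in> S" "y \<in> S"
  shows "midpoint x y \<in> S"
  using convexD[OF assms, of "1/2" "1/2"] by (simp add: midpoint_def scaleR_right_distrib)

text \<open>Stands in for weak compactness. The distances \<open>r k\<close> from 0 to
  \<open>A k\<close> increase to a limit \<open>R\<close>, so almost-shortest vectors and their
  midpoints all have norm close to \<open>R\<close>, which forces the vectors together.\<close>

lemma nested_closed_convex_Int_nonempty:
  fixes A :: "nat \<Rightarrow> 'a::{real_inner, complete_space} set"
  assumes cl: "\<And>k. closed (A k)" and cv: "\<And>k. convex (A k)" and ne: "\<And>k. A k \<noteq> {}"
    and dec: "decseq A" and bd: "bounded (A 0)"
  obtains x where "\<And>k. x \<in> A k"
proof -
  define r where "r k = infdist 0 (A k)" for k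
  obtain B where B: "\<And>x. x \<in> A 0 \<Longrightarrow> norm x \<le> B"
    using bd by (auto simp: bounded_iff)
  have sub: "A j \<subseteq> A k" if "k \<le> j" for j k
    using dec that by (rule decseqD)
  have rle: "r k \<le> norm x" if "x \<in> A k" for k x
    unfolding r_def using infdist_le[OF that, of 0] by simp
  have r0: "0 \<le> r k" for k
    by (simp add: r_def infdist_nonneg)
  have rB: "r k \<le> B" for k
    using ne[of k] rle B sub[of 0 k] by (meson all_not_in_conv le0 order_trans subsetD)
  have inc: "incseq r"
    unfolding incseq_def r_def by (intro allI impI infdist_mono sub ne)
  obtain R where R: "r \<longlonglongrightarrow> R" and rR: "\<And>k. r k \<le> R"
    using incseq_convergent[OF inc] rB by metis
  have "\<exists>x\<in>A k. norm x < r k + 1 / real (Suc k)" for k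
  proof (rule ccontr)
    assume "\<not> ?thesis"
    then have "r k + 1 / real (Suc k) \<le> infdist 0 (A k)"
      unfolding infdist_notempty[OF ne] by (intro cINF_greatest ne) (auto simp: not_less)
    then show False by (simp add: r_def)
  qed
  then obtain x where xA: "\<And>k. x k \<in> A k" and xr: "\<And>k. norm (x k) < r k + 1 / real (Suc k)"
    by metis
  \<comment> \<open>The right-hand side of \<open>norm_diff_midpoint\<close> for \<open>x k\<close>
    and \<open>x j\<close> with \<open>k \<le> j\<close>: both norms are at most
    \<open>R + 1 / real (Suc k)\<close>, and the midpoint lies in \<open>A k\<close>, so its norm is
    at least \<open>r k\<close>. The bound does not depend on \<open>j\<close>.\<close>
  define a where "a k = 4 * (R + 1 / real (Suc k))\<^sup>2 - 4 * (r k)\<^sup>2" for k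
  have "a \<longlonglongrightarrow> 4 * (R + 0)\<^sup>2 - 4 * R\<^sup>2"
    unfolding a_def by (intro tendsto_intros R LIMSEQ_Suc[OF lim_1_over_n])
  then have a0: "a \<longlonglongrightarrow> 0" by simp
  have bound: "(dist (x k) (x j))\<^sup>2 \<le> a k" if "k \<le> j" for j k
  proof -
    have "midpoint (x k) (x j) \<in> A k"
      using xA[of j] sub[OF that] by (intro midpoint_in_convex cv xA) auto
    then have m: "(r k)\<^sup>2 \<le> (norm (midpoint (x k) (x j)))\<^sup>2"
      by (intro power_mono rle r0)
    have k: "(norm (x k))\<^sup>2 \<le> (R + 1 / real (Suc k))\<^sup>2"
      using xr[of k] rR[of k] by (intro power_mono) auto
    have "1 / real (Suc j) \<le> 1 / real (Suc k)"
      using that by (intro divide_left_mono) auto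
    then have j: "(norm (x j))\<^sup>2 \<le> (R + 1 / real (Suc k))\<^sup>2"
      using xr[of j] rR[of j] by (intro power_mono norm_ge_zero) linarith
    show ?thesis
      unfolding dist_norm norm_diff_midpoint a_def using m k j by linarith
  qed
  have "Cauchy x"
  proof (rule CauchyI')
    fix e :: real assume e: "0 < e"
    then have "0 < e\<^sup>2" by simp
    then have "eventually (\<lambda>k. a k < e\<^sup>2) sequentially"
      using a0 by (simp add: order_tendstoD(2))
    then obtain M where M: "\<And>k. k \<ge> M \<Longrightarrow> a k < e\<^sup>2"
      by (auto simp: eventually_sequentially)
    have "dist (x k) (x j) < e" if "k \<ge> M" "k < j" for k j
    proof (rule power2_less_imp_less)
      show "(dist (x k) (x j))\<^sup>2 < e\<^sup>2"
        using bound[of k j] M[of k] that by simp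
    qed (use e in simp)
    then show "\<exists>M. \<forall>m\<ge>M. \<forall>n>m. dist (x m) (x n) < e" by blast
  qed
  then obtain l where l: "x \<longlonglongrightarrow> l"
    using Cauchy_convergent convergent_def by blast
  \<comment> \<open>From index \<open>k\<close> on, the sequence stays in the closed set
    \<open>A k\<close>.\<close>
  have "l \<in> A k" for k
  proof (rule Lim_in_closed_set[OF cl _ _ l])
    show "eventually (\<lambda>j. x j \<in> A k) sequentially"
      unfolding eventually_sequentially using xA sub by blast
  qed simp
  then show thesis by (rule that)
qed

text \<open>The balls around \<open>x\<close> with radii slightly above \<open>infdist x Q\<close>
  cut \<open>Q\<close> in nested nonempty sets. Letting the slack tend to 0 shows that a common
  point attains the distance.\<close>

lemma nearest_point_exists:
  fixes Q :: "'a::{real_inner, complete_space} set"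
  assumes "Q \<noteq> {}" "closed Q" "convex Q"
  obtains p where "p \<in> Q" "dist x p = infdist x Q"
proof -
  define A where "A k = Q \<inter> cball x (infdist x Q + 1 / real (Suc k))" for k
  have ne: "A k \<noteq> {}" for k
  proof
    assume "A k = {}"
    then have "infdist x Q + 1 / real (Suc k) \<le> infdist x Q"
      unfolding infdist_notempty[OF assms(1)]
      by (intro cINF_greatest assms(1)) (force simp: A_def infdist_notempty[OF assms(1)])
    then show False by simp
  qed
  have dec: "decseq A"
    unfolding decseq_def A_def
    by (intro allI impI Int_mono order_refl subset_cball add_left_mono divide_left_mono) auto
  obtain p where p: "\<And>k. p \<in> A k"
  proof (rule nested_closed_convex_Int_nonempty[of A])
    show "closed (A k)" "convex (A k)" "bounded (A 0)" for k
      unfolding A_def using assms by (simp_all add: closed_Int convex_Int bounded_Int)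
  qed (use ne dec in auto)
  have "(\<lambda>k. infdist x Q + 1 / real (Suc k)) \<longlonglongrightarrow> infdist x Q + 0"
    by (intro tendsto_intros LIMSEQ_Suc[OF lim_1_over_n])
  then have "dist x p \<le> infdist x Q + 0"
    by (rule LIMSEQ_le_const) (use p in \<open>auto simp: A_def\<close>)
  moreover have "p \<in> Q" using p[of 0] by (simp add: A_def)
  ultimately show thesis
    using that infdist_le[of p Q x] by simp
qed

text \<open>With nearest points \<open>p\<close> and \<open>q\<close>, the same convex combination
  of \<open>x - p\<close> and \<open>y - q\<close> stays in the ball of radius \<open>c\<close>, and
  that of \<open>p\<close> and \<open>q\<close> stays in \<open>Q\<close>.\<close>

lemma convex_infdist_sublevel:
  fixes Q :: "'a::{real_inner, complete_space} set"
  assumes "Q \<noteq> {}" "closed Q" "convex Q"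
  shows "convex {x. infdist x Q \<le> c}"
proof (rule convexI, clarsimp)
  fix x y and u v :: real
  assume le: "infdist x Q \<le> c" "infdist y Q \<le> c" and uv: "0 \<le> u" "0 \<le> v" "u + v = 1"
  obtain p where p: "p \<in> Q" "dist x p = infdist x Q" by (rule nearest_point_exists[OF assms])
  obtain q where q: "q \<in> Q" "dist y q = infdist y Q" by (rule nearest_point_exists[OF assms])
  have "u *\<^sub>R (x - p) + v *\<^sub>R (y - q) \<in> cball 0 c"
    using p q le uv by (intro convexD convex_cball) (auto simp: dist_norm norm_minus_commute)
  then have "norm (u *\<^sub>R (x - p) + v *\<^sub>R (y - q)) \<le> c"
    by simp
  moreover have "(u *\<^sub>R x + v *\<^sub>R y) - (u *\<^sub>R p + v *\<^sub>R q) = u *\<^sub>R (x - p) + v *\<^sub>R (y - q)"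
    by (simp add: algebra_simps)
  ultimately have "dist (u *\<^sub>R x + v *\<^sub>R y) (u *\<^sub>R p + v *\<^sub>R q) \<le> c"
    by (simp add: dist_norm)
  moreover have "u *\<^sub>R p + v *\<^sub>R q \<in> Q"
    using assms(3) p q uv by (intro convexD)
  ultimately show "infdist (u *\<^sub>R x + v *\<^sub>R y) Q \<le> c"
    using infdist_le order_trans by blast
qed

lemma bounded_infdist_sublevel:
  fixes Q :: "'a::real_normed_vector set"
  assumes "Q \<noteq> {}" "bounded Q"
  shows "bounded {x. infdist x Q \<le> c}"
proof -
  obtain B where B: "\<And>q. q \<in> Q \<Longrightarrow> norm q \<le> B"
    using assms(2) by (auto simp: bounded_iff)
  have "norm x \<le> B + c" if "infdist x Q \<le> c" for x
  proof -
    have "norm x - B \<le> infdist x Q"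
      unfolding infdist_notempty[OF assms(1)]
    proof (intro cINF_greatest assms(1))
      fix q assume "q \<in> Q"
      then show "norm x - B \<le> dist x q"
        using B[of q] norm_triangle_ineq2[of x q] by (simp add: dist_norm)
    qed
    then show ?thesis using that by simp
  qed
  then show ?thesis by (auto simp: bounded_iff)
qed

section \<open>Strict convexity and the strict midpoint inequality\<close>

lemma strictly_convex_imp_convex:
  assumes "strictly_convex A"
  shows "convex A"
proof (rule convexI)
  fix x y and u v :: real
  assume xy: "x \<in> A" "y \<in> A" and uv: "0 \<le> u" "0 \<le> v" "u + v = 1"
  show "u *\<^sub>R x + v *\<^sub>R y \<in> A"
  proof (cases "x = y \<or> u = 0 \<or> v = 0")
    case True
    then show ?thesis using xy uv by (auto simp flip: scaleR_add_left)
  next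
    case False
    then have "u *\<^sub>R x + (1 - u) *\<^sub>R y \<in> interior A"
      using assms xy uv unfolding strictly_convex_def by auto
    then show ?thesis using uv interior_subset[of A] by (auto simp: eq_diff_eq[symmetric] add.commute)
  qed
qed

text \<open>A small step from \<open>p\<close> towards \<open>z\<close> remains in \<open>Q\<close>
  and comes closer to \<open>z\<close>.\<close>

lemma infdist_less_dist_interior:
  fixes Q :: "'a::real_normed_vector set"
  assumes "p \<in> interior Q" "z \<noteq> p"
  shows "infdist z Q < dist z p"
proof -
  obtain e where e: "0 < e" "cball p e \<subseteq> Q"
    using assms(1) by (auto simp: mem_interior_cball)
  define d where "d = dist z p"
  have d: "0 < d" using assms(2) by (simp add: d_def)
  \<comment> \<open>The bound 1 prevents overshooting \<open>z\<close>; the bound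
    \<open>e / d\<close> keeps \<open>w\<close> within \<open>e\<close> of \<open>p\<close>.\<close>
  define s where "s = min 1 (e / d)"
  have s: "0 < s" "s \<le> 1" "s * d \<le> e"
    using e d by (auto simp: s_def min_def field_simps)
  define w where "w = p + s *\<^sub>R (z - p)"
  have "dist p w = s * d"
    using s by (simp add: w_def dist_norm d_def)
  then have "w \<in> Q" using e s by auto
  have "z - w = (1 - s) *\<^sub>R (z - p)"
    by (simp add: w_def algebra_simps)
  then have "dist z w = (1 - s) * d"
    using s by (simp add: dist_norm d_def)
  also have "\<dots> < d" using s d by simp
  finally show ?thesis
    using infdist_le[OF \<open>w \<in> Q\<close>, of z] by (simp add: d_def)
qed

lemma infdist_midpoint_less:
  fixes Q :: "'a::{real_inner, complete_space} set"
  assumes "Q \<noteq> {}" "closed Q" "strictly_convex Q"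
    and le: "infdist x Q \<le> c" "infdist y Q \<le> c" and c: "0 < c" and "x \<noteq> y"
  shows "infdist (midpoint x y) Q < c"
proof -
  have cv: "convex Q" by (rule strictly_convex_imp_convex[OF assms(3)])
  obtain p where p: "p \<in> Q" "dist x p = infdist x Q"
    by (rule nearest_point_exists[OF assms(1,2) cv])
  obtain q where q: "q \<in> Q" "dist y q = infdist y Q"
    by (rule nearest_point_exists[OF assms(1,2) cv])
  have eq: "midpoint x y - midpoint p q = midpoint (x - p) (y - q)"
    by (simp add: midpoint_def algebra_simps)
  have sq: "(norm (x - p))\<^sup>2 \<le> c\<^sup>2" "(norm (y - q))\<^sup>2 \<le> c\<^sup>2"
    using p q le by (auto simp flip: dist_norm intro!: power_mono infdist_nonneg)
  have dist_le: "dist (midpoint x y) (midpoint p q) \<le> c"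
  proof (rule power2_le_imp_le)
    show "(dist (midpoint x y) (midpoint p q))\<^sup>2 \<le> c\<^sup>2"
      unfolding dist_norm eq using sq norm_diff_midpoint[of "x - p" "y - q"]
        zero_le_power2[of "norm ((x - p) - (y - q))"] by linarith
  qed (use c in simp)
  show ?thesis
  proof (cases "p = q")
    case True
    \<comment> \<open>This term of the parallelogram identity makes the midpoint estimate
      strict.\<close>
    have "0 < (norm ((x - p) - (y - q)))\<^sup>2"
      using True \<open>x \<noteq> y\<close> by simp
    moreover have "midpoint x y - p = midpoint (x - p) (y - q)"
      using eq True by simp
    ultimately have "(norm (midpoint x y - p))\<^sup>2 < c\<^sup>2"
      using sq norm_diff_midpoint[of "x - p" "y - q"] by simp
    then have "dist (midpoint x y) p < c"
      unfolding dist_norm by (rule power2_less_imp_less) (use c in simp)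
    then show ?thesis
      using infdist_le[OF p(1), of "midpoint x y"] by simp
  next
    case False
    have "(1/2) *\<^sub>R p + (1 - 1/2) *\<^sub>R q \<in> interior Q"
      by (rule assms(3)[unfolded strictly_convex_def, rule_format, OF p(1) q(1) False]) simp
    then have int: "midpoint p q \<in> interior Q"
      by (simp add: midpoint_def algebra_simps)
    show ?thesis
    proof (cases "midpoint x y = midpoint p q")
      \<comment> \<open>The midpoint of \<open>x\<close> and \<open>y\<close> now lies in
        \<open>Q\<close>, so its distance is 0 and strictness comes from
        \<open>0 < c\<close>.\<close>
      case True
      then show ?thesis using int interior_subset[of Q] c by auto
    next
      case False
      then show ?thesis using infdist_less_dist_interior[OF int] dist_le by force
    qed
  qed
qed

section \<open>Minimal time for the unit ball as a distance\<close>

lemma minimal_time_cball: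
  fixes Q :: "'a::real_normed_vector set"
  assumes "Q \<noteq> {}"
  shows "minimal_time (cball 0 1) x Q = ereal (infdist x Q)"
proof -
  define S where "S = {t::real. t \<ge> 0 \<and> ((\<lambda>f. x + t *\<^sub>R f) ` cball 0 1) \<inter> Q \<noteq> {}}"
  have inS: "dist x q \<in> S" if "q \<in> Q" for q
  proof -
    \<comment> \<open>The unit direction towards \<open>q\<close> reaches it at time
      \<open>dist x q\<close>. If \<open>q = x\<close>, then \<open>sgn 0 = 0\<close> and the time
      is 0.\<close>
    have "x + dist x q *\<^sub>R sgn (q - x) = q"
      by (cases "q = x") (auto simp: sgn_div_norm dist_norm norm_minus_commute)
    moreover have "sgn (q - x) \<in> cball 0 1" by (simp add: norm_sgn)
    ultimately show ?thesis using that unfolding S_def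
      by (metis (mono_tags, lifting) IntI imageI empty_iff mem_Collect_eq zero_le_dist)
  qed
  have lb: "infdist x Q \<le> t" if t: "t \<in> S" for t
  proof -
    obtain f where "t \<ge> 0" "norm f \<le> 1" "x + t *\<^sub>R f \<in> Q"
      using t by (auto simp: S_def)
    then show ?thesis
      using infdist_le[of "x + t *\<^sub>R f" Q x] mult_left_mono[of "norm f" 1 t]
      by (simp add: dist_norm)
  qed
  have "Inf (ereal ` S) = ereal (infdist x Q)"
  proof (rule Inf_eqI)
    fix y assume y: "\<And>i. i \<in> ereal ` S \<Longrightarrow> y \<le> i"
    have yq: "y \<le> ereal (dist x q)" if "q \<in> Q" for q
      using y[of "ereal (dist x q)"] inS[OF that] by simp
    show "y \<le> ereal (infdist x Q)"
    \<comment> \<open>A lower bound of minus infinity is trivial, and plus infinity is excluded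
      because \<open>Q\<close> has a point at finite distance.\<close>
    proof (cases y)
      case (real r)
      then show ?thesis
        using yq unfolding infdist_notempty[OF assms] by (simp, intro cINF_greatest assms, simp)
    qed (use yq assms in auto)
  qed (use lb in auto)
  then show ?thesis by (simp add: minimal_time_def S_def)
qed

section \<open>Existence and uniqueness of the minimizer\<close>

theorem theorem3p4:
  fixes F :: "'a::{real_inner, complete_space} set"
    and C :: "'a set"
    and \<Omega> :: "nat \<Rightarrow> 'a set"
    and n :: nat
  assumes "F = cball 0 1"
    and "C \<noteq> {}" and "closed C" and "convex C"
    and "n \<ge> 1"
    and "\<And>i. i \<in> {1..n} \<Longrightarrow> \<Omega> i \<noteq> {}"
    and "\<And>i. i \<in> {1..n} \<Longrightarrow> closed (\<Omega> i)"
    and "\<And>i. i \<in> {1..n} \<Longrightarrow> strictly_convex (\<Omega> i)"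
    and "bounded C \<or> (\<exists>i\<in>{1..n}. bounded (\<Omega> i))"
    and "(\<Inter>i\<in>{1..n}. \<Omega> i \<inter> C) = {}"
  shows "\<exists>!x. is_solution (max_time F \<Omega> n) C x"
proof -
  define I where "I = {1..n}"
  have I: "finite I" "I \<noteq> {}" using assms(5) by (auto simp: I_def)
  note ne = assms(6)[folded I_def] and cl = assms(7)[folded I_def]
    and sc = assms(8)[folded I_def]
  define g where "g x = Max ((\<lambda>i. infdist x (\<Omega> i)) ` I)" for x
  have g_le: "g x \<le> c \<longleftrightarrow> (\<forall>i\<in>I. infdist x (\<Omega> i) \<le> c)" for x c
    using I by (simp add: g_def)
  have g_less: "g x < c \<longleftrightarrow> (\<forall>i\<in>I. infdist x (\<Omega> i) < c)" for x c
    using I by (simp add: g_def)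
  have "max_time F \<Omega> n x = ereal (g x)" for x
  proof -
    have "max_time F \<Omega> n x = Max (ereal ` (\<lambda>i. infdist x (\<Omega> i)) ` I)"
      unfolding max_time_def I_def[symmetric] assms(1) image_image
      by (intro arg_cong[where f = Max] image_cong refl minimal_time_cball ne)
    also have "\<dots> = ereal (g x)"
      unfolding g_def using I by (intro mono_Max_commute[symmetric]) (auto simp: mono_def)
    finally show ?thesis .
  qed
  then have sol: "is_solution (max_time F \<Omega> n) C x \<longleftrightarrow> x \<in> C \<and> (\<forall>y\<in>C. g x \<le> g y)" for x
    by (simp add: is_solution_def)
  have g0: "0 \<le> g x" for x
    using I infdist_nonneg g_le[of x "g x"] by (meson all_not_in_conv order_refl order_trans)
  have bdd: "bdd_below (g ` C)"
    using g0 by (intro bdd_belowI[of _ 0]) auto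
  define m where "m = Inf (g ` C)"
  have m_le: "m \<le> g y" if "y \<in> C" for y
    unfolding m_def by (rule cINF_lower[OF bdd that])
  \<comment> \<open>The slack makes each set nonempty before the infimum \<open>m\<close> is known
    to be attained; a common point of all of them attains it.\<close>
  define A where "A k = C \<inter> {x. g x \<le> m + 1 / real (Suc k)}" for k
  have A_eq: "A k = C \<inter> (\<Inter>i\<in>I. {x. infdist x (\<Omega> i) \<le> m + 1 / real (Suc k)})" for k
    by (auto simp: A_def g_le)
  have "closed (A k)" for k
    unfolding A_eq by (intro closed_Int closed_INT ballI closed_Collect_le continuous_intros assms(3))
  moreover have "convex (A k)" for k
    unfolding A_eq
    by (intro convex_Int convex_INT convex_infdist_sublevel ne cl strictly_convex_imp_convex sc assms(4))
  moreover have "A k \<noteq> {}" for k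
  proof
    assume "A k = {}"
    then have "m + 1 / real (Suc k) \<le> m"
      unfolding m_def using assms(2) by (intro cINF_greatest) (force simp: A_def m_def)+
    then show False by simp
  qed
  moreover have "decseq A"
    unfolding decseq_def A_def
    by (intro allI impI Int_mono order_refl Collect_mono)
      (erule order_trans, intro add_left_mono divide_left_mono, auto)
  moreover have "bounded (A 0)"
    using assms(9)
  proof
    assume "bounded C"
    then show ?thesis by (rule bounded_subset) (auto simp: A_def)
  next
    assume "\<exists>i\<in>{1..n}. bounded (\<Omega> i)"
    then obtain i where i: "i \<in> I" "bounded (\<Omega> i)" by (auto simp: I_def)
    show ?thesis
      by (rule bounded_subset[OF bounded_infdist_sublevel[OF ne[OF i(1)] i(2)]])
        (use i(1) in \<open>auto simp: A_eq\<close>)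
  qed
  ultimately obtain x where x: "\<And>k. x \<in> A k"
    using nested_closed_convex_Int_nonempty[of A] by metis
  then have xC: "x \<in> C" by (simp add: A_def)
  have "(\<lambda>k. m + 1 / real (Suc k)) \<longlonglongrightarrow> m + 0"
    by (intro tendsto_intros LIMSEQ_Suc[OF lim_1_over_n])
  then have "g x \<le> m + 0"
    by (rule LIMSEQ_le_const) (use x in \<open>auto simp: A_def\<close>)
  then have gx: "g x \<le> g y" if "y \<in> C" for y
    using m_le[OF that] by simp
  \<comment> \<open>If all distances vanished at \<open>x\<close>, closedness would put
    \<open>x\<close> in every \<open>\<Omega> i\<close>, against the empty intersection within
    \<open>C\<close>.\<close>
  have pos: "0 < g x"
  proof (rule ccontr)
    assume "\<not> 0 < g x"
    then have "\<forall>i\<in>I. infdist x (\<Omega> i) = 0"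
      using g_le[of x 0] infdist_nonneg by (metis antisym not_less)
    then have "\<forall>i\<in>I. x \<in> \<Omega> i"
      using in_closed_iff_infdist_zero[OF cl ne] by blast
    then have "x \<in> (\<Inter>i\<in>{1..n}. \<Omega> i \<inter> C)" using xC by (simp add: I_def)
    then show False using assms(10) by blast
  qed
  show ?thesis
  proof (rule ex1I)
    show "is_solution (max_time F \<Omega> n) C x" using sol xC gx by blast
  next
    fix y assume "is_solution (max_time F \<Omega> n) C y"
    then have yC: "y \<in> C" and gy: "g y \<le> g x" using sol xC by auto
    show "y = x"
    proof (rule ccontr)
      assume "y \<noteq> x"
      \<comment> \<open>Both points have distance at most \<open>g x\<close> to each
        \<open>\<Omega> i\<close>, so the strict midpoint inequality applies with \<open>c\<close>
        equal to \<open>g x\<close>.\<close>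
      have "infdist (midpoint y x) (\<Omega> i) < g x" if "i \<in> I" for i
        using that \<open>y \<noteq> x\<close> pos gy g_le
        by (intro infdist_midpoint_less ne cl sc) auto
      then have "g (midpoint y x) < g x" by (simp add: g_less)
      moreover have "midpoint y x \<in> C"
        using assms(4) yC xC by (rule midpoint_in_convex)
      ultimately show False using gx by fastforce
    qed
  qed
qed

end
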